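(* Let $G$ be a connected simple graph with vertices $v_1,\dots,v_n$, $\mathbb{K}$ a field, and $A=(a_{ij})$ an $n\times n$ matrix over $\mathbb{K}$ with $a_{ij}=0$ whenever $i\neq j$ and $v_i,v_j$ are not adjacent. Let $\omega=w_1w_2\cdots w_m$ be a word over $\{v_1,\dots,v_n\}$ in which each $v_i$ occurs $m_i\ge 1$ times, and let $s=(m_1,\dots,m_n)$ (so $m=\sum_i m_i$). Let $B={}^e(A-I,s)$, an $m\times m$ matrix whose rows and columns are indexed by $u_1u_2\cdots u_m$, and let $\bar\omega=\bar w_1\cdots\bar w_m$ be the sequence obtained from $\omega$ by replacing the $k$-th occurrence of $v_i$ by $u_{\sum_{j=1}^{i-1}m_j+k}$. Then $$(G,A,\omega)=I+{}^c\big((I-B_{\bar\omega})^{-1},s\big)(A-I).$$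
   Context: Linear SDS over a word: the local function of $v_i$ is $x_i\mapsto a_{i1}x_1+\cdots+a_{in}x_n$, inducing the $n\times n$ matrix $F_{v_i}$ equal to the identity except that its $i$-th row is $(a_{i1},\dots,a_{in})$; for the word $\omega=w_1\cdots w_m$ the system map is $(G,A,\omega)=F_{w_m}F_{w_{m-1}}\cdots F_{w_1}$. Block-expansion: for an $n\times n$ matrix $T=(t_{ij})$ and $s=(m_1,\dots,m_n)$ with $m_k\ge1$, ${}^e(T,s)$ is the $m\times m$ matrix obtained by replacing each entry $t_{ij}$ by an $m_i\times m_j$ block all of whose entries equal $t_{ij}$. Block-compression: for an $m\times m$ matrix $T$ and such $s$, ${}^c(T,s)$ is the $n\times n$ matrix whose $(r,l)$ entry is the sum of all entries of $T$ in rows $\sum_{k<r}m_k+1,\dots,\sum_{k\le r}m_k$ and columns $\sum_{k<l}m_k+1,\dots,\sum_{k\le l}m_k$. For a square matrix $T$ with rows and columns indexed by elements $u_1,\dots,u_m$ and a linear arrangement $\sigma$ of these elements, $T_\sigma$ is the matrix with $[T_\sigma]_{pq}=[T]_{pq}$ if $u_p$ appears after $u_q$ in $\sigma$ and $0$ otherwise. $I$ denotes the identity matrix of the appropriate size. *)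

theory Defs
  imports "Graph_Theory.Graph_Theory" "Jordan_Normal_Form.Gauss_Jordan_Elimination"
begin

text \<open>
  All indices are 0-based: the vertices \<open>v\<^sub>1, \<dots>, v\<^sub>n\<close> are the numbers \<open>0, \<dots>, n - 1\<close>,
  matrix rows and columns are numbered from 0, and \<open>u\<^sub>1, \<dots>, u\<^sub>m\<close> are \<open>0, \<dots>, m - 1\<close>.
\<close>

definition sds_local :: "'a::comm_ring_1 mat \<Rightarrow> nat \<Rightarrow> 'a vec \<Rightarrow> 'a vec" where
  "sds_local A i x =
     vec (dim_vec x) (\<lambda>r. if r = i then (\<Sum>j<dim_vec x. A $$ (i, j) * x $ j) else x $ r)"

definition sds_mat :: "'a::comm_ring_1 mat \<Rightarrow> nat \<Rightarrow> 'a mat" where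
  "sds_mat A i =
     mat (dim_row A) (dim_row A)
       (\<lambda>(r, c). if r = i then A $$ (i, c) else 1\<^sub>m (dim_row A) $$ (r, c))"

lemma sds_mat_mult_vec:
  assumes "A \<in> carrier_mat n n" "x \<in> carrier_vec n"
  shows "sds_mat A i *\<^sub>v x = sds_local A i x"
proof (rule eq_vecI)
  show "dim_vec (sds_mat A i *\<^sub>v x) = dim_vec (sds_local A i x)"
    using assms by (simp add: sds_mat_def sds_local_def)
next
  fix r assume "r < dim_vec (sds_local A i x)"
  then have r: "r < n" using assms by (simp add: sds_local_def)
  have "(\<Sum>c = 0..<n. (if r = c then 1 else 0) * x $ c) = (\<Sum>c = 0..<n. if r = c then x $ c else 0)"
    by (rule sum.cong) auto
  then have unit: "(\<Sum>c = 0..<n. (if r = c then 1 else 0) * x $ c) = x $ r"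
    using r by simp
  show "(sds_mat A i *\<^sub>v x) $ r = sds_local A i x $ r"
    using assms r unit
    by (auto simp: sds_mat_def sds_local_def scalar_prod_def lessThan_atLeast0 intro!: sum.cong)
qed

text \<open>
  \<open>sds_map A [i, \<dots>, j] = sds_mat A j * \<dots> * sds_mat A i\<close>: the first letter is applied first, hence it is
  the rightmost factor. The graph enters only through the zero pattern of \<open>A\<close>.
\<close>

definition sds_map :: "'a::comm_ring_1 mat \<Rightarrow> nat list \<Rightarrow> 'a mat" where
  "sds_map A w = fold (\<lambda>i M. sds_mat A i * M) w (1\<^sub>m (dim_row A))"

definition block :: "nat list \<Rightarrow> nat \<Rightarrow> nat set" where
  "block s r = {sum_list (take r s)..<sum_list (take (Suc r) s)}"

definition block_index :: "nat list \<Rightarrow> nat \<Rightarrow> nat" where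
  "block_index s p = (THE r. r < length s \<and> p \<in> block s r)"

definition block_expansion :: "'a mat \<Rightarrow> nat list \<Rightarrow> 'a mat" where
  "block_expansion T s =
     mat (sum_list s) (sum_list s) (\<lambda>(p, q). T $$ (block_index s p, block_index s q))"

definition block_compression :: "'a::comm_monoid_add mat \<Rightarrow> nat list \<Rightarrow> 'a mat" where
  "block_compression T s =
     mat (length s) (length s) (\<lambda>(r, l). \<Sum>p\<in>block s r. \<Sum>q\<in>block s l. T $$ (p, q))"

definition appears_after :: "'b list \<Rightarrow> 'b \<Rightarrow> 'b \<Rightarrow> bool" where
  "appears_after \<sigma> a b \<longleftrightarrow> (\<exists>i j. j < i \<and> i < length \<sigma> \<and> \<sigma> ! i = a \<and> \<sigma> ! j = b)"

definition order_restriction :: "'a::zero mat \<Rightarrow> nat list \<Rightarrow> 'a mat" where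
  "order_restriction T \<sigma> =
     mat (dim_row T) (dim_col T) (\<lambda>(p, q). if appears_after \<sigma> p q then T $$ (p, q) else 0)"

text \<open>
  If position \<open>t\<close> of \<open>w\<close> holds the \<open>k\<close>-th occurrence of \<open>i = w ! t\<close>, then
  \<open>count_list (take t w) i = k - 1\<close>; counting from 0, this is the offset of the letter
  inside block \<open>i\<close>.
\<close>

definition relabel_word :: "nat list \<Rightarrow> nat list \<Rightarrow> nat list" where
  "relabel_word s w =
     map (\<lambda>t. sum_list (take (w ! t) s) + count_list (take t w) (w ! t)) [0..<length w]"

end

theory Submission
  imports Defs "Jordan_Normal_Form.Determinant"
begin

text \<open>
  Put \<open>C = A - I\<close>, let \<open>L\<close> be the order restriction of \<open>B\<close>, and let \<open>X = (I - L)\<^sup>-\<^sup>1 E\<close>, where row \<open>p\<close>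
  of \<open>E\<close> is the row of \<open>C\<close> belonging to the block of \<open>p\<close>. Read along the relabelled word,
  \<open>(I - L) X = E\<close> is a recurrence that expresses each row of \<open>X\<close> through the preceding ones. It says
  that the \<open>t\<close>-th row of \<open>X\<close> is the increment which the \<open>t\<close>-th update adds to row \<open>w\<^sub>t\<close> of the partial
  product of the local matrices. Summing the increments of every vertex gives the compression of
  \<open>(I - L)\<^sup>-\<^sup>1\<close> times \<open>C\<close>. The same triangularity shows that \<open>I - L\<close> has trivial kernel.
\<close>

section \<open>Consecutive blocks as a partition of the indices\<close>

lemma block_disjoint:
  assumes "p \<in> block s r" "p \<in> block s r'"
  shows "r = r'"
proof -
  have le: "sum_list (take a s) \<le> sum_list (take b s)" if "a \<le> b" for a b
  proof -
    have "take b s = take a s @ take (b - a) (drop a s)"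
      using that by (metis le_add_diff_inverse take_add)
    then show ?thesis by simp
  qed
  have "\<not> a < b" if "p \<in> block s a" "p \<in> block s b" for a b
    using that le[of "Suc a" b] by (force simp: block_def)
  then show ?thesis using assms by (meson linorder_less_linear)
qed

lemma block_index_eq:
  assumes "r < length s" "p \<in> block s r"
  shows "block_index s p = r"
  unfolding block_index_def using assms block_disjoint by blast

text \<open>Working with every prefix of \<open>s\<close> lets the induction on \<open>k\<close> go
  through; later uses take \<open>k = length s\<close>.\<close>

lemma block_cover:
  assumes "p < sum_list (take k s)" "k \<le> length s"
  shows "\<exists>r<k. p \<in> block s r"
  using assms
proof (induction k)
  case (Suc k)
  then show ?case
    by (cases "p < sum_list (take k s)") (auto simp: block_def intro: less_SucI)
qed simp

lemma block_subset:
  assumes "r < length s"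
  shows "block s r \<subseteq> {0..<sum_list s}"
proof -
  have "sum_list s = sum_list (take (Suc r) s) + sum_list (drop (Suc r) s)"
    by (metis append_take_drop_id sum_list_append)
  then show ?thesis by (auto simp: block_def)
qed

text \<open>Intervals become fibres of \<open>block_index\<close>, so that sums over blocks can be
  regrouped as sums over fibres.\<close>

lemma block_eq_block_index:
  assumes "r < length s"
  shows "block s r = {p. p < sum_list s \<and> block_index s p = r}"
  using block_subset[OF assms] block_index_eq[OF assms] block_cover[of _ "length s" s]
    block_index_eq[of _ s] by fastforce

lemma block_index_less:
  assumes "p < sum_list s"
  shows "block_index s p < length s"
  using block_cover[of p "length s" s] assms block_index_eq by fastforce

lemma sum_blocks:
  fixes f :: "nat \<Rightarrow> 'a::comm_monoid_add"
  shows "(\<Sum>r<length s. \<Sum>p\<in>block s r. f p) = (\<Sum>p<sum_list s. f p)"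
proof -
  have "(\<Sum>r<length s. \<Sum>p\<in>block s r. f p) =
      (\<Sum>r<length s. \<Sum>p\<in>{p \<in> {..<sum_list s}. block_index s p = r}. f p)"
    by (auto simp: block_eq_block_index intro!: sum.cong)
  also have "\<dots> = (\<Sum>p<sum_list s. f p)"
    by (rule sum.group) (auto simp: block_index_less)
  finally show ?thesis .
qed

section \<open>Triangularity along a linear arrangement\<close>

lemma index_mult_mat_sum:
  assumes "D \<in> carrier_mat n k" "N \<in> carrier_mat k l" "p < n" "j < l"
  shows "(D * N) $$ (p, j) = (\<Sum>q<k. D $$ (p, q) * N $$ (q, j))"
  using assms by (auto simp: scalar_prod_def lessThan_atLeast0 intro!: sum.cong)

lemma index_mult_mat_vec_sum:
  assumes "D \<in> carrier_mat n k" "v \<in> carrier_vec k" "p < n"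
  shows "(D *\<^sub>v v) $ p = (\<Sum>q<k. D $$ (p, q) * v $ q)"
  using assms by (auto simp: scalar_prod_def lessThan_atLeast0 intro!: sum.cong)

lemma appears_after_distinct:
  assumes "distinct \<sigma>" "t < length \<sigma>" "t' < length \<sigma>"
  shows "appears_after \<sigma> (\<sigma> ! t) (\<sigma> ! t') \<longleftrightarrow> t' < t"
proof
  assume "appears_after \<sigma> (\<sigma> ! t) (\<sigma> ! t')"
  then obtain i j where "j < i" "i < length \<sigma>" "\<sigma> ! i = \<sigma> ! t" "\<sigma> ! j = \<sigma> ! t'"
    unfolding appears_after_def by blast
  then show "t' < t"
    using assms nth_eq_iff_index_eq[OF assms(1)] by auto
next
  assume "t' < t"
  then show "appears_after \<sigma> (\<sigma> ! t) (\<sigma> ! t')"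
    unfolding appears_after_def using assms(2) by blast
qed

text \<open>The list \<sigma> is a bijection from positions to indices. After reindexing by it the
  restricted matrix is strictly lower triangular, so its row at position \<open>t\<close> sees only
  earlier positions.\<close>

lemma sum_order_restriction_row:
  fixes B :: "'a::comm_ring_1 mat"
  assumes B: "B \<in> carrier_mat m m"
    and \<sigma>: "distinct \<sigma>" "set \<sigma> = {..<m}" and t: "t < m"
  shows "(\<Sum>q<m. order_restriction B \<sigma> $$ (\<sigma> ! t, q) * f q) =
    (\<Sum>t'<t. B $$ (\<sigma> ! t, \<sigma> ! t') * f (\<sigma> ! t'))"
proof -
  have len: "length \<sigma> = m"
    using \<sigma> distinct_card by fastforce
  have less: "\<sigma> ! k < m" if "k < m" for k
    using that len \<sigma>(2) nth_mem by fastforce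
  have "(\<Sum>q<m. order_restriction B \<sigma> $$ (\<sigma> ! t, q) * f q) =
      (\<Sum>t'<m. order_restriction B \<sigma> $$ (\<sigma> ! t, \<sigma> ! t') * f (\<sigma> ! t'))"
    using bij_betw_nth[OF \<sigma>(1) _ \<sigma>(2)[symmetric]] len
    by (intro sum.reindex_bij_betw[symmetric]) auto
  also have "\<dots> = (\<Sum>t'<m. if t' \<in> {..<t} then B $$ (\<sigma> ! t, \<sigma> ! t') * f (\<sigma> ! t') else 0)"
    using B t less len appears_after_distinct[OF \<sigma>(1)]
    by (intro sum.cong) (auto simp: order_restriction_def)
  also have "\<dots> = (\<Sum>t'\<in>{..<m} \<inter> {..<t}. B $$ (\<sigma> ! t, \<sigma> ! t') * f (\<sigma> ! t'))"
    by (simp add: sum.inter_restrict)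
  also have "{..<m} \<inter> {..<t} = {..<t}"
    using t by auto
  finally show ?thesis .
qed

text \<open>The function \<open>f\<close> is kept arbitrary because it is later both a kernel vector
  and a column of the solution of a linear system.\<close>

lemma sum_one_minus_order_restriction_row:
  fixes B :: "'a::comm_ring_1 mat"
  assumes B: "B \<in> carrier_mat m m"
    and \<sigma>: "distinct \<sigma>" "set \<sigma> = {..<m}" and t: "t < m"
  shows "(\<Sum>q<m. (1\<^sub>m m - order_restriction B \<sigma>) $$ (\<sigma> ! t, q) * f q) =
    f (\<sigma> ! t) - (\<Sum>t'<t. B $$ (\<sigma> ! t, \<sigma> ! t') * f (\<sigma> ! t'))"
proof -
  have less: "\<sigma> ! t < m"
    using t \<sigma> distinct_card[OF \<sigma>(1)] nth_mem[of t \<sigma>] by auto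
  have "(\<Sum>q<m. (1\<^sub>m m - order_restriction B \<sigma>) $$ (\<sigma> ! t, q) * f q) =
      (\<Sum>q<m. (if q = \<sigma> ! t then f q else 0) - order_restriction B \<sigma> $$ (\<sigma> ! t, q) * f q)"
    using B less by (intro sum.cong) (auto simp: order_restriction_def algebra_simps)
  also have "\<dots> = f (\<sigma> ! t) - (\<Sum>q<m. order_restriction B \<sigma> $$ (\<sigma> ! t, q) * f q)"
    using less by (simp add: sum_subtractf)
  finally show ?thesis
    using sum_order_restriction_row[OF assms] by simp
qed

text \<open>A singular matrix would have a nonzero kernel vector. Each of its entries is a
  combination of the entries at earlier positions of \<sigma>, so forward substitution makes all of
  them vanish.\<close>

lemma det_one_minus_order_restriction:
  fixes B :: "'a::field mat"
  assumes B: "B \<in> carrier_mat m m" and \<sigma>: "distinct \<sigma>" "set \<sigma> = {..<m}"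
  shows "det (1\<^sub>m m - order_restriction B \<sigma>) \<noteq> 0"
proof
  let ?D = "1\<^sub>m m - order_restriction B \<sigma>"
  have D: "?D \<in> carrier_mat m m"
    using B by (auto simp: order_restriction_def)
  assume "det ?D = 0"
  then obtain v where v: "v \<in> carrier_vec m" "v \<noteq> 0\<^sub>v m" "?D *\<^sub>v v = 0\<^sub>v m"
    using det_0_iff_vec_prod_zero[OF D] by blast
  have len: "length \<sigma> = m"
    using \<sigma> distinct_card by fastforce
  have zero: "t < m \<Longrightarrow> v $ (\<sigma> ! t) = 0" for t
  proof (induction t rule: less_induct)
    case (less t)
    have \<sigma>t: "\<sigma> ! t < m"
      using less.prems len \<sigma>(2) nth_mem by fastforce
    have "0 = (?D *\<^sub>v v) $ (\<sigma> ! t)"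
      using v \<sigma>t by simp
    also have "\<dots> = (\<Sum>q<m. ?D $$ (\<sigma> ! t, q) * v $ q)"
      by (rule index_mult_mat_vec_sum[OF D v(1) \<sigma>t])
    also have "\<dots> = v $ (\<sigma> ! t) - (\<Sum>t'<t. B $$ (\<sigma> ! t, \<sigma> ! t') * v $ (\<sigma> ! t'))"
      by (rule sum_one_minus_order_restriction_row[OF assms less.prems])
    also have "(\<Sum>t'<t. B $$ (\<sigma> ! t, \<sigma> ! t') * v $ (\<sigma> ! t')) = 0"
      using less by (intro sum.neutral) auto
    finally show ?case by simp
  qed
  have "v $ p = 0" if "p < m" for p
    using that zero len \<sigma>(2) by (metis in_set_conv_nth lessThan_iff)
  then have "v = 0\<^sub>v m"
    using v(1) by (intro eq_vecI) auto
  then show False using v(2) by simp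
qed

text \<open>\<open>mat_inverse\<close> returns an option. A nonzero determinant makes
  \<open>D\<close> a unit of the matrix ring, which rules out \<open>None\<close>, so
  \<open>the\<close> yields a genuine two-sided inverse.\<close>

lemma mat_inverse_det:
  fixes D :: "'a::field mat"
  assumes D: "D \<in> carrier_mat m m" and "det D \<noteq> 0"
  shows "the (mat_inverse D) \<in> carrier_mat m m"
    and "D * the (mat_inverse D) = 1\<^sub>m m"
    and "the (mat_inverse D) * D = 1\<^sub>m m"
proof -
  have "D \<in> Units (ring_mat TYPE('a) m undefined)"
    using det_non_zero_imp_unit[OF assms] .
  then obtain N where "mat_inverse D = Some N"
    using mat_inverse(1)[OF D] by fastforce
  then show "the (mat_inverse D) \<in> carrier_mat m m"
    "D * the (mat_inverse D) = 1\<^sub>m m" "the (mat_inverse D) * D = 1\<^sub>m m"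
    using mat_inverse(2)[OF D] by auto
qed

section \<open>The relabelled word as an arrangement of all indices\<close>

lemma count_list_take_less:
  assumes "t < t'" "t' \<le> length w"
  shows "count_list (take t w) (w ! t) < count_list (take t' w) (w ! t)"
proof -
  have "take t' w = take t w @ w ! t # take (t' - Suc t) (drop (Suc t) w)"
    using assms id_take_nth_drop[of t "take t' w"] by (simp add: drop_take min_def)
  then show ?thesis by simp
qed

lemma sum_list_count_list:
  assumes "set w \<subseteq> {0..<length s}" "\<And>i. i < length s \<Longrightarrow> s ! i = count_list w i"
  shows "sum_list s = length w"
proof -
  have "sum_list s = (\<Sum>i\<in>{0..<length s}. count_list w i)"
    using assms(2) by (simp add: sum_list_sum_nth)
  also have "\<dots> = length w"
    using assms(1) by (intro sum_count_set) auto
  finally show ?thesis .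
qed

lemma length_relabel_word [simp]: "length (relabel_word s w) = length w"
  by (simp add: relabel_word_def)

text \<open>The offset counts only occurrences strictly before \<open>t\<close>. The one at
  \<open>t\<close> itself is left out, so the offset stays below the block length.\<close>

lemma relabel_word_in_block:
  assumes "set w \<subseteq> {0..<length s}" "\<And>i. i < length s \<Longrightarrow> s ! i = count_list w i"
    and "t < length w"
  shows "relabel_word s w ! t \<in> block s (w ! t)"
proof -
  have wt: "w ! t < length s"
    using assms(1,3) nth_mem by fastforce
  have "count_list (take t w) (w ! t) < s ! (w ! t)"
    using count_list_take_less[of t "length w" w] assms wt by simp
  then show ?thesis
    using assms(3) wt by (simp add: relabel_word_def block_def take_Suc_conv_app_nth)
qed

text \<open>Equal labels lie in one block and hence come from one letter, but the offsets of
  successive occurrences of a letter strictly increase.\<close>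

lemma distinct_relabel_word:
  assumes "set w \<subseteq> {0..<length s}" "\<And>i. i < length s \<Longrightarrow> s ! i = count_list w i"
  shows "distinct (relabel_word s w)"
proof -
  have "relabel_word s w ! t \<noteq> relabel_word s w ! t'" if "t < t'" "t' < length w" for t t'
  proof
    assume eq: "relabel_word s w ! t = relabel_word s w ! t'"
    then have "w ! t = w ! t'"
      using relabel_word_in_block[OF assms, of t] relabel_word_in_block[OF assms, of t'] that
        block_disjoint by force
    then show False
      using eq that count_list_take_less[of t t' w] by (simp add: relabel_word_def)
  qed
  then show ?thesis
    by (metis distinct_conv_nth length_relabel_word linorder_neqE_nat)
qed

text \<open>Surjectivity by counting: there are \<open>length w\<close> distinct labels, all below
  \<open>sum_list s = length w\<close>.\<close>

lemma set_relabel_word: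
  assumes "set w \<subseteq> {0..<length s}" "\<And>i. i < length s \<Longrightarrow> s ! i = count_list w i"
  shows "set (relabel_word s w) = {..<length w}"
proof (rule card_subset_eq)
  show "set (relabel_word s w) \<subseteq> {..<length w}"
  proof
    fix p assume "p \<in> set (relabel_word s w)"
    then obtain t where t: "t < length w" "p = relabel_word s w ! t"
      by (metis in_set_conv_nth length_relabel_word)
    then have "w ! t < length s"
      using assms(1) nth_mem by fastforce
    then show "p \<in> {..<length w}"
      using block_subset relabel_word_in_block[OF assms t(1)] t(2) sum_list_count_list[OF assms]
      by fastforce
  qed
  show "card (set (relabel_word s w)) = card {..<length w}"
    using distinct_card[OF distinct_relabel_word[OF assms]] by simp
qed simp

section \<open>The system map as a sum of increments\<close>

lemma sds_map_Nil: "sds_map A [] = 1\<^sub>m (dim_row A)"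
  by (simp add: sds_map_def)

lemma sds_map_snoc: "sds_map A (w @ [i]) = sds_mat A i * sds_map A w"
  by (simp add: sds_map_def)

lemma sds_mat_carrier [simp]: "A \<in> carrier_mat n n \<Longrightarrow> sds_mat A i \<in> carrier_mat n n"
  by (auto simp: sds_mat_def)

lemma sds_map_carrier [simp]:
  assumes "A \<in> carrier_mat n n"
  shows "sds_map A w \<in> carrier_mat n n"
proof (induction w rule: rev_induct)
  case (snoc i w)
  then show ?case
    using mult_carrier_mat[OF sds_mat_carrier[OF assms]] by (simp add: sds_map_snoc)
qed (use assms in \<open>simp add: sds_map_Nil\<close>)

text \<open>Row \<open>i\<close> of the local matrix is the unit row plus row \<open>i\<close> of
  \<open>A - I\<close>, and all other rows are unit rows. This is where \<open>A - I\<close>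
  enters.\<close>

lemma sds_mat_mult_index:
  fixes A M :: "'a::comm_ring_1 mat"
  assumes A: "A \<in> carrier_mat n n" and M: "M \<in> carrier_mat n n"
    and i: "i < n" and r: "r < n" and j: "j < n"
  shows "(sds_mat A i * M) $$ (r, j) =
    M $$ (r, j) + (if r = i then \<Sum>c<n. (A - 1\<^sub>m n) $$ (i, c) * M $$ (c, j) else 0)"
proof -
  have "(sds_mat A i * M) $$ (r, j) = (\<Sum>c<n. sds_mat A i $$ (r, c) * M $$ (c, j))"
    by (rule index_mult_mat_sum[OF sds_mat_carrier[OF A] M r j])
  also have "\<dots> = (\<Sum>c<n. (if c = r then M $$ (c, j) else 0) +
      (if r = i then (A - 1\<^sub>m n) $$ (i, c) * M $$ (c, j) else 0))"
    using A r i by (intro sum.cong) (auto simp: sds_mat_def algebra_simps)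
  also have "\<dots> = M $$ (r, j) + (if r = i then \<Sum>c<n. (A - 1\<^sub>m n) $$ (i, c) * M $$ (c, j) else 0)"
    using r by (simp add: sum.distrib)
  finally show ?thesis .
qed

text \<open>In the fixed column \<open>j\<close>, \<open>Y t\<close> is what update \<open>t\<close>
  adds to row \<open>w ! t\<close>. The induction appends letters on the right because the last
  letter is the leftmost factor.\<close>

lemma sds_map_index:
  fixes A :: "'a::comm_ring_1 mat"
  assumes A: "A \<in> carrier_mat n n" and w: "set w \<subseteq> {0..<n}"
    and j: "j < n" and r: "r < n"
    and Y: "\<And>t. t < length w \<Longrightarrow>
      Y t = (A - 1\<^sub>m n) $$ (w ! t, j) + (\<Sum>t'<t. (A - 1\<^sub>m n) $$ (w ! t, w ! t') * Y t')"
  shows "sds_map A w $$ (r, j) = 1\<^sub>m n $$ (r, j) + (\<Sum>t<length w. if w ! t = r then Y t else 0)"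
  using w Y r
proof (induction w arbitrary: r rule: rev_induct)
  case Nil
  then show ?case using A by (simp add: sds_map_Nil)
next
  case (snoc i w)
  let ?C = "A - 1\<^sub>m n"
  have i: "i < n" using snoc.prems by simp
  have IH: "sds_map A w $$ (c, j) = 1\<^sub>m n $$ (c, j) + (\<Sum>t<length w. if w ! t = c then Y t else 0)"
    if "c < n" for c
  proof (rule snoc.IH[OF _ _ that])
    show "set w \<subseteq> {0..<n}" using snoc.prems by simp
    fix t assume t: "t < length w"
    have "(\<Sum>t'<t. ?C $$ ((w @ [i]) ! t, (w @ [i]) ! t') * Y t') =
        (\<Sum>t'<t. ?C $$ (w ! t, w ! t') * Y t')"
      using t by (intro sum.cong) (auto simp: nth_append)
    then show "Y t = ?C $$ (w ! t, j) + (\<Sum>t'<t. ?C $$ (w ! t, w ! t') * Y t')"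
      using snoc.prems(2)[of t] t by (simp add: nth_append)
  qed
  \<comment> \<open>Row \<open>i\<close> of \<open>?C\<close> acts on the identity plus the
    accumulated increments. These two parts give the two terms of the recurrence.\<close>
  have "(\<Sum>c<n. ?C $$ (i, c) * sds_map A w $$ (c, j)) =
      (\<Sum>c<n. (if c = j then ?C $$ (i, c) else 0) +
        (\<Sum>t<length w. if w ! t = c then ?C $$ (i, c) * Y t else 0))"
    using j by (intro sum.cong)
      (auto simp: IH distrib_left sum_distrib_left intro!: sum.cong)
  also have "\<dots> = ?C $$ (i, j) +
      (\<Sum>c<n. \<Sum>t<length w. if w ! t = c then ?C $$ (i, c) * Y t else 0)"
    using j by (simp add: sum.distrib)
  \<comment> \<open>After the exchange, each position \<open>t\<close> contributes through the
    single row \<open>c = w ! t\<close>.\<close>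
  also have "(\<Sum>c<n. \<Sum>t<length w. if w ! t = c then ?C $$ (i, c) * Y t else 0) =
      (\<Sum>t<length w. \<Sum>c<n. if w ! t = c then ?C $$ (i, c) * Y t else 0)"
    by (rule sum.swap)
  also have "\<dots> = (\<Sum>t<length w. ?C $$ (i, w ! t) * Y t)"
  proof (rule sum.cong)
    fix t assume "t \<in> {..<length w}"
    then have "w ! t \<in> {..<n}"
      using snoc.prems(1) nth_mem by fastforce
    then show "(\<Sum>c<n. if w ! t = c then ?C $$ (i, c) * Y t else 0) = ?C $$ (i, w ! t) * Y t"
      by simp
  qed simp
  also have "\<dots> = (\<Sum>t<length w. ?C $$ (i, (w @ [i]) ! t) * Y t)"
    by (intro sum.cong) (auto simp: nth_append)
  \<comment> \<open>The appended letter sits at position \<open>length w\<close>, counting from 0,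
    so this is the recurrence for the newest increment.\<close>
  also have "?C $$ (i, j) + \<dots> = Y (length w)"
    using snoc.prems(2)[of "length w"] by simp
  finally have step: "(\<Sum>c<n. ?C $$ (i, c) * sds_map A w $$ (c, j)) = Y (length w)" .
  have "(\<Sum>t<length w. if (w @ [i]) ! t = r then Y t else 0) =
      (\<Sum>t<length w. if w ! t = r then Y t else 0)"
    by (intro sum.cong) (auto simp: nth_append)
  then show ?case
    using sds_mat_mult_index[OF A sds_map_carrier[OF A, of w] i snoc.prems(3) j,
        unfolded step IH[OF snoc.prems(3)]]
    by (auto simp: sds_map_snoc add.assoc)
qed

text \<open>All columns of block \<open>l\<close> meet the same row \<open>l\<close> of
  \<open>C\<close>. Compressing columns and then multiplying by \<open>C\<close> thus amounts to
  multiplying by \<open>C\<close> with its rows repeated, and only the summation over row blocks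
  remains.\<close>

lemma block_compression_mult_index:
  fixes N C :: "'a::comm_ring_1 mat"
  assumes "C \<in> carrier_mat (length s) k" and r: "r < length s" and j: "j < k"
  shows "(block_compression N s * C) $$ (r, j) =
    (\<Sum>p\<in>block s r. \<Sum>q<sum_list s. N $$ (p, q) * C $$ (block_index s q, j))"
proof -
  have "(block_compression N s * C) $$ (r, j) =
      (\<Sum>l<length s. (\<Sum>p\<in>block s r. \<Sum>q\<in>block s l. N $$ (p, q)) * C $$ (l, j))"
    using assms
    by (auto simp: block_compression_def scalar_prod_def lessThan_atLeast0 intro!: sum.cong)
  also have "\<dots> = (\<Sum>l<length s. \<Sum>p\<in>block s r. \<Sum>q\<in>block s l.
      N $$ (p, q) * C $$ (block_index s q, j))"
    by (auto simp: sum_distrib_right block_index_eq intro!: sum.cong)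
  also have "\<dots> = (\<Sum>p\<in>block s r. \<Sum>l<length s. \<Sum>q\<in>block s l.
      N $$ (p, q) * C $$ (block_index s q, j))"
    by (rule sum.swap)
  finally show ?thesis by (simp add: sum_blocks)
qed

section \<open>Identification of the increments with the rows of the solution\<close>

theorem theorem3:
  fixes G :: "(nat, 'e) pre_digraph"
    and A B :: "'a::field mat"
    and n m :: nat
    and w s :: "nat list"
  assumes "graph G"
    and "Digraph_Component.connected G"
    and "verts G = {0..<n}"
    and "A \<in> carrier_mat n n"
    and "\<And>i j. i < n \<Longrightarrow> j < n \<Longrightarrow> i \<noteq> j \<Longrightarrow> \<not> (i \<rightarrow>\<^bsub>G\<^esub> j) \<Longrightarrow> A $$ (i, j) = 0"
    and "set w \<subseteq> {0..<n}"
    and "length w = m"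
    and "length s = n"
    and "\<And>i. i < n \<Longrightarrow> s ! i = count_list w i"
    and "\<And>i. i < n \<Longrightarrow> s ! i \<ge> 1"
    and "B = block_expansion (A - 1\<^sub>m n) s"
  shows "invertible_mat (1\<^sub>m m - order_restriction B (relabel_word s w)) \<and>
    sds_map A w =
      1\<^sub>m n + block_compression
        (the (mat_inverse (1\<^sub>m m - order_restriction B (relabel_word s w)))) s * (A - 1\<^sub>m n)"
proof -
  let ?C = "A - 1\<^sub>m n" and ?\<sigma> = "relabel_word s w"
  let ?D = "1\<^sub>m m - order_restriction B ?\<sigma>"
  let ?N = "the (mat_inverse ?D)"
  note A = \<open>A \<in> carrier_mat n n\<close> and len_s = \<open>length s = n\<close> and len_w = \<open>length w = m\<close>
  have w: "set w \<subseteq> {0..<length s}"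
    and s: "\<And>i. i < length s \<Longrightarrow> s ! i = count_list w i"
    using assms by auto
  have sum_s: "sum_list s = m"
    using sum_list_count_list[OF w s] len_w by simp
  have dist: "distinct ?\<sigma>" and set_\<sigma>: "set ?\<sigma> = {..<m}"
    using distinct_relabel_word[OF w s] set_relabel_word[OF w s] len_w by auto
  have B: "B \<in> carrier_mat m m"
    using assms sum_s by (simp add: block_expansion_def)
  have D: "?D \<in> carrier_mat m m"
    using B by (auto simp: order_restriction_def)
  note N = mat_inverse_det[OF D det_one_minus_order_restriction[OF B dist set_\<sigma>]]
  have inv: "invertible_mat ?D"
    using D N unfolding invertible_mat_def inverts_mat_def
    by (metis carrier_matD square_mat.elims(3))
  have \<sigma>_less: "?\<sigma> ! t < m" if "t < m" for t
    using that set_\<sigma> len_w nth_mem[of t ?\<sigma>] by simp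
  have wt: "w ! t < n" if "t < m" for t
    using that subsetD[OF w nth_mem[of t]] len_s len_w by simp
  have index_\<sigma>: "block_index s (?\<sigma> ! t) = w ! t" if "t < m" for t
    using that relabel_word_in_block[OF w s] len_w len_s wt block_index_eq by simp
  \<comment> \<open>The rows of \<open>E\<close> are written directly through
    \<open>block_index\<close>, so \<open>E\<close> is never formed as a matrix.\<close>
  define X where "X p j = (\<Sum>q<m. ?N $$ (p, q) * ?C $$ (block_index s q, j))" for p j
  have solve: "(\<Sum>q<m. ?D $$ (p, q) * X q j) = ?C $$ (block_index s p, j)" if "p < m" for p j
  proof -
    have one: "(\<Sum>q<m. ?D $$ (p, q) * ?N $$ (q, k)) = (if k = p then 1 else 0)" if "k < m" for k
    proof -
      have "(\<Sum>q<m. ?D $$ (p, q) * ?N $$ (q, k)) = (?D * ?N) $$ (p, k)"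
        by (rule index_mult_mat_sum[OF D N(1) \<open>p < m\<close> that, symmetric])
      then show ?thesis
        using N(2) \<open>p < m\<close> that by simp
    qed
    have "(\<Sum>q<m. ?D $$ (p, q) * X q j) =
        (\<Sum>q<m. \<Sum>k<m. ?D $$ (p, q) * ?N $$ (q, k) * ?C $$ (block_index s k, j))"
      by (simp only: X_def sum_distrib_left mult.assoc)
    also have "\<dots> = (\<Sum>k<m. \<Sum>q<m. ?D $$ (p, q) * ?N $$ (q, k) * ?C $$ (block_index s k, j))"
      by (rule sum.swap)
    also have "\<dots> = (\<Sum>k<m. (if k = p then 1 else 0) * ?C $$ (block_index s k, j))"
      by (intro sum.cong) (simp_all only: sum_distrib_right[symmetric] one lessThan_iff)
    also have "\<dots> = (\<Sum>k<m. if k = p then ?C $$ (block_index s k, j) else 0)"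
      by (intro sum.cong) auto
    finally show ?thesis
      using that by simp
  qed
  \<comment> \<open>Row \<open>?\<sigma> ! t\<close> of the system just solved. Between two labels
    \<open>B\<close> has the entry of \<open>?C\<close> at their letters, which turns the system
    into the recurrence required by \<open>sds_map_index\<close>.\<close>
  have rec: "X (?\<sigma> ! t) j =
      ?C $$ (w ! t, j) + (\<Sum>t'<t. ?C $$ (w ! t, w ! t') * X (?\<sigma> ! t') j)" if t: "t < m" for t j
  proof -
    have "(\<Sum>t'<t. B $$ (?\<sigma> ! t, ?\<sigma> ! t') * X (?\<sigma> ! t') j) =
        (\<Sum>t'<t. ?C $$ (w ! t, w ! t') * X (?\<sigma> ! t') j)"
      using t \<open>B = _\<close> \<sigma>_less index_\<sigma> sum_s
      by (intro sum.cong) (auto simp: block_expansion_def)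
    then show ?thesis
      using solve[OF \<sigma>_less[OF t], of j] index_\<sigma>[OF t]
        sum_one_minus_order_restriction_row[OF B dist set_\<sigma> t, of "\<lambda>q. X q j"]
      by (simp add: algebra_simps)
  qed
  have "sds_map A w = 1\<^sub>m n + block_compression ?N s * ?C"
  proof (rule eq_matI)
    fix r j
    assume "r < dim_row (1\<^sub>m n + block_compression ?N s * ?C)"
      and "j < dim_col (1\<^sub>m n + block_compression ?N s * ?C)"
    then have r: "r < n" and j: "j < n"
      using A len_s by (auto simp: block_compression_def)
    have "sds_map A w $$ (r, j) = 1\<^sub>m n $$ (r, j) + (\<Sum>t<m. if w ! t = r then X (?\<sigma> ! t) j else 0)"
      using sds_map_index[OF A _ j r, of w "\<lambda>t. X (?\<sigma> ! t) j"] w rec len_w len_s by simp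
    also have "(\<Sum>t<m. if w ! t = r then X (?\<sigma> ! t) j else 0) =
        (\<Sum>t<m. if block_index s (?\<sigma> ! t) = r then X (?\<sigma> ! t) j else 0)"
      using index_\<sigma> by (intro sum.cong) auto
    \<comment> \<open>Passing from positions to labels turns the occurrences of \<open>r\<close> in
      \<open>w\<close> into block \<open>r\<close>, over which the compression sums its
      rows.\<close>
    also have "\<dots> = (\<Sum>p<m. if block_index s p = r then X p j else 0)"
      using bij_betw_nth[OF dist _ set_\<sigma>[symmetric]] len_w
      by (intro sum.reindex_bij_betw) auto
    also have "\<dots> = (\<Sum>p\<in>{p \<in> {..<m}. block_index s p = r}. X p j)"
      by (rule sum.inter_filter[symmetric]) simp
    also have "{p \<in> {..<m}. block_index s p = r} = block s r"
      using block_eq_block_index[of r s] r len_s sum_s by simp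
    also have "(\<Sum>p\<in>block s r. X p j) = (block_compression ?N s * ?C) $$ (r, j)"
      using block_compression_mult_index[of ?C s n r j ?N] r j len_s sum_s
        minus_carrier_mat[OF one_carrier_mat, of A n]
      by (simp add: X_def)
    finally show "sds_map A w $$ (r, j) = (1\<^sub>m n + block_compression ?N s * ?C) $$ (r, j)"
      using r j A len_s by (simp add: block_compression_def)
  qed (use carrier_matD[OF sds_map_carrier[OF A, of w]] A len_s in
      \<open>auto simp: block_compression_def\<close>)
  then show ?thesis
    using inv by blast
qed

end
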